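(* Let $d\ge 1$ be an integer. There is no online algorithm with advice for online unit clustering in $\mathbb{R}^d$ which serves optimally all request sequences of length at least $n$ while reading fewer than $\frac{d\log_2 3}{1+4d}\cdot n$ bits of advice on each of them; that is, any online algorithm with advice that serves every request sequence optimally must, for arbitrarily large $n$, read at least $\frac{d\log_2 3}{1+4d}\cdot n$ bits of advice on some request sequence of $n$ points.
   Context: Online unit clustering in $\mathbb{R}^d$: points of $\mathbb{R}^d$ with the $L_\infty$ norm arrive one by one; upon arrival each point must be irrevocably assigned to a cluster (an existing one or a newly opened one), and every cluster must have $L_\infty$-diameter at most $1$ (i.e. fit in an axis-parallel unit cube). The cost is the number of clusters; serving a sequence optimally means using the offline minimum number of clusters. Online algorithm with advice (tape model): an oracle knowing the whole input writes an infinite binary advice tape, which the algorithm may read sequentially; the advice complexity is the number of bits read. *)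

theory Defs
  imports "HOL-Analysis.Analysis"
begin

text \<open>The $L_\infty$-diameter, defined like the library's Euclidean \<^const>\<open>diameter\<close>.\<close>

definition linf_diameter :: "(real ^ 'd) set \<Rightarrow> real" where
  "linf_diameter S = (if S = {} then 0 else SUP (x, y) \<in> S \<times> S. infnorm (x - y))"

text \<open>A solution for a request sequence \<open>\<sigma>\<close> is a list of cluster labels: the \<open>i\<close>-th request
  goes to the cluster labelled \<open>cs ! i\<close>. Opening a new cluster means using a label not used
  before. Requests may repeat, so labels are attached to positions rather than to points.\<close>

definition cluster :: "(real ^ 'd) list \<Rightarrow> nat list \<Rightarrow> nat \<Rightarrow> (real ^ 'd) set" where
  "cluster \<sigma> cs c = {\<sigma> ! i | i. i < length \<sigma> \<and> cs ! i = c}"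

definition unit_clustering :: "(real ^ 'd) list \<Rightarrow> nat list \<Rightarrow> bool" where
  "unit_clustering \<sigma> cs \<longleftrightarrow>
     length cs = length \<sigma> \<and> (\<forall>c \<in> set cs. linf_diameter (cluster \<sigma> cs c) \<le> 1)"

definition cost :: "nat list \<Rightarrow> nat" where
  "cost cs = card (set cs)"

definition opt_cost :: "(real ^ 'd) list \<Rightarrow> nat" where
  "opt_cost \<sigma> = (LEAST k. \<exists>cs. unit_clustering \<sigma> cs \<and> cost cs = k)"

definition optimal_clustering :: "(real ^ 'd) list \<Rightarrow> nat list \<Rightarrow> bool" where
  "optimal_clustering \<sigma> cs \<longleftrightarrow> unit_clustering \<sigma> cs \<and> cost cs = opt_cost \<sigma>"

text \<open>A deterministic online algorithm knows exactly the requests that have arrived (the last one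
  being the request currently served) and the advice bits it has read so far. From these it
  determines its next action: read the next bit of the tape, or assign the current request
  irrevocably to a cluster. No computability is required.\<close>

datatype action = Read_Bit | Assign nat

type_synonym 'd online_algorithm = "(real ^ 'd) list \<Rightarrow> bool list \<Rightarrow> action"

type_synonym tape = "nat \<Rightarrow> bool"

definition tape_prefix :: "tape \<Rightarrow> nat \<Rightarrow> bool list" where
  "tape_prefix \<phi> b = map \<phi> [0..<b]"

text \<open>\<open>run A \<phi> \<sigma> cs b\<close>: on tape \<open>\<phi>\<close>, algorithm \<open>A\<close> serves \<open>\<sigma>\<close> with the assignments \<open>cs\<close>, having
  read exactly the first \<open>b\<close> bits of \<open>\<phi>\<close> in total. If \<open>A\<close> reads forever on some request, there is
  no such run; this is not excluded for tapes other than the one the oracle writes.\<close>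

inductive run :: "'d::finite online_algorithm \<Rightarrow> tape \<Rightarrow> (real ^ 'd) list \<Rightarrow> nat list \<Rightarrow> nat \<Rightarrow> bool"
  for A :: "'d online_algorithm" and \<phi> :: tape
where
  start: "run A \<phi> [] [] 0"
| serve: "run A \<phi> (\<sigma> @ [x]) (cs @ [c]) b'"
    if "run A \<phi> \<sigma> cs b" and "b \<le> b'"
      and "\<forall>j. b \<le> j \<and> j < b' \<longrightarrow> A (\<sigma> @ [x]) (tape_prefix \<phi> j) = Read_Bit"
      and "A (\<sigma> @ [x]) (tape_prefix \<phi> b') = Assign c"

lemma run_unique:
  assumes "run A \<phi> \<sigma> cs b" and "run A \<phi> \<sigma> cs' b'"
  shows "cs = cs' \<and> b = b'"
  using assms
proof (induction arbitrary: cs' b' rule: run.induct)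
  case start
  then show ?case by (auto elim: run.cases)
next
  case (serve \<sigma> cs b b1 x c)
  from serve.prems obtain ds d a where
    *: "cs' = ds @ [d]" "run A \<phi> \<sigma> ds a" "a \<le> b'"
      "\<forall>j. a \<le> j \<and> j < b' \<longrightarrow> A (\<sigma> @ [x]) (tape_prefix \<phi> j) = Read_Bit"
      "A (\<sigma> @ [x]) (tape_prefix \<phi> b') = Assign d"
    by (cases rule: run.cases) auto
  have "cs = ds" "b = a" using serve.IH[OF *(2)] by auto
  moreover have "b1 = b'"
    using serve.hyps * \<open>b = a\<close> by (metis action.distinct(1) linorder_neqE_nat)
  ultimately show ?case using serve.hyps * by auto
qed

text \<open>An oracle writes a tape depending on the whole request sequence.\<close>

type_synonym 'd oracle_fun = "(real ^ 'd) list \<Rightarrow> tape"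

end

theory Submission imports Defs begin

text \<open>Far apart from each other, place \<open>k\<close> gadgets. A gadget consists of a centre \<open>c\<close>, then the
  points \<open>c \<plusminus> e\<^sub>i/2\<close> for every axis \<open>i\<close>, and then for every axis the points \<open>c + 11/10 s\<^sub>i e\<^sub>i\<close>
  and \<open>c - s\<^sub>i e\<^sub>i\<close>, where the sign \<open>s\<^sub>i \<in> {-1, 0, 1}\<close> is still unknown when the first \<open>1 + 2d\<close>
  points are served. An optimal solution opens one cluster for \<open>c\<close> and one for every axis with
  \<open>s\<^sub>i \<noteq> 0\<close>, and it must separate \<open>c + t e\<^sub>i/2\<close> from \<open>c\<close> if and only if \<open>t = s\<^sub>i\<close>. So the
  assignments of the early points reveal all signs, and the advice read on the \<open>3\<^sup>d\<^sup>k\<close> inputs forms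
  a prefix-free code; hence on one of them \<open>d k log\<^sub>2 3\<close> bits are read, for \<open>(1 + 4 d) k\<close> points.\<close>

section \<open>Runs and tapes\<close>

text \<open>Actions depend only on the requests seen so far, so cutting off the last requests of a
  run leaves a run, and it has read no more bits.\<close>

lemma run_append:
  assumes "run A \<phi> \<sigma> cs b" "\<sigma> = P @ Q"
  shows "\<exists>b'\<le>b. run A \<phi> P (take (length P) cs) b'"
  using assms
proof (induction arbitrary: Q rule: run.induct)
  case start
  then show ?case by (auto intro: run.start)
next
  case (serve \<sigma> cs b b' x c)
  have len: "length cs = length \<sigma>"
    using serve.hyps(1) by (induction rule: run.induct) auto
  show ?case
  proof (cases Q rule: rev_cases)
    case Nil
    then have P: "P = \<sigma> @ [x]" using serve.prems by simp
    show ?thesis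
      using run.serve[OF serve.hyps(1-4)] len unfolding P by auto
  next
    case (snoc Q' y)
    then have "\<sigma> = P @ Q'" using serve.prems by simp
    from serve.IH[OF this] obtain a where "a \<le> b" "run A \<phi> P (take (length P) cs) a" by blast
    then show ?thesis using serve.hyps(2) len \<open>\<sigma> = P @ Q'\<close> by (intro exI[of _ a]) auto
  qed
qed

lemma tape_prefix_take: "m \<le> n \<Longrightarrow> tape_prefix \<phi> m = take m (tape_prefix \<phi> n)"
  by (simp add: tape_prefix_def take_map)

text \<open>Every tape prefix consulted along the run has length at most \<open>b\<close>, so bits
  from position \<open>n\<close> on cannot influence it.\<close>

lemma run_tape_cong:
  assumes "run A \<phi> \<sigma> cs b" "tape_prefix \<phi> n = tape_prefix \<phi>' n" "b \<le> n"
  shows "run A \<phi>' \<sigma> cs b"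
  using assms
proof (induction rule: run.induct)
  case start
  then show ?case by (auto intro: run.start)
next
  case (serve \<sigma> cs b b' x c)
  have eq: "tape_prefix \<phi> j = tape_prefix \<phi>' j" if "j \<le> b'" for j
    using that serve.prems by (simp add: tape_prefix_take[of j n])
  show ?case
    using serve eq by (intro run.serve) auto
qed

section \<open>Unit clusterings\<close>

lemma linf_diameter_le_iff:
  assumes "finite S" "S \<noteq> {}"
  shows "linf_diameter S \<le> 1 \<longleftrightarrow> (\<forall>x\<in>S. \<forall>y\<in>S. infnorm (x - y) \<le> 1)"
proof -
  have "linf_diameter S \<le> 1 \<longleftrightarrow> (\<forall>p\<in>S \<times> S. (case p of (x, y) \<Rightarrow> infnorm (x - y)) \<le> 1)"
    unfolding linf_diameter_def using assms by (auto simp: cSUP_le_iff)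
  then show ?thesis by auto
qed

lemma infnorm_le_iff:
  fixes x :: "real ^ 'd"
  shows "infnorm x \<le> r \<longleftrightarrow> (\<forall>i. \<bar>x $ i\<bar> \<le> r)"
proof -
  have "infnorm x = (SUP i\<in>UNIV. \<bar>x $ i\<bar>)"
    by (simp add: infnorm_cart full_SetCompr_eq)
  then show ?thesis by (simp add: cSUP_le_iff)
qed

text \<open>The distinct list \<open>xs\<close> names the positions: \<open>p\<close> may repeat a
  point, yet the labels remain a function of the index.\<close>

lemma unit_clustering_map_iff:
  assumes "distinct xs"
  shows "unit_clustering (map p xs) (map f xs) \<longleftrightarrow>
    (\<forall>x\<in>set xs. \<forall>y\<in>set xs. f x = f y \<longrightarrow> infnorm (p x - p y) \<le> 1)"
proof -
  have cl: "cluster (map p xs) (map f xs) c = p ` {x \<in> set xs. f x = c}" for c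
  proof -
    have "cluster (map p xs) (map f xs) c = {p (xs ! i) | i. i < length xs \<and> f (xs ! i) = c}"
      unfolding cluster_def by (intro Collect_cong ex_cong1) auto
    then show ?thesis by (auto simp: in_set_conv_nth)
  qed
  have "linf_diameter (cluster (map p xs) (map f xs) c) \<le> 1 \<longleftrightarrow>
      (\<forall>x\<in>set xs. \<forall>y\<in>set xs. f x = c \<and> f y = c \<longrightarrow> infnorm (p x - p y) \<le> 1)"
    if "c \<in> f ` set xs" for c
    unfolding cl by (subst linf_diameter_le_iff) (use that in auto)
  then show ?thesis unfolding unit_clustering_def by auto
qed

lemma map_label_obtain:
  assumes "distinct xs" "length cs = length xs"
  obtains f where "cs = map f xs"
proof
  show "cs = map (the \<circ> map_of (zip xs cs)) xs"
    using assms by (auto intro!: nth_equalityI simp: map_of_zip_nth)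
qed

section \<open>The gadgets\<close>

datatype 'd slot =
  Centre (block: nat) | Half (block: nat) 'd int | Outer (block: nat) 'd | Counter (block: nat) 'd

text \<open>The word \<open>w\<close> gives the sign of every axis of every gadget. For sign \<open>0\<close>, the points \<open>Outer\<close>
  and \<open>Counter\<close> repeat the centre.\<close>

fun coord :: "(nat \<times> 'd \<Rightarrow> int) \<Rightarrow> 'd slot \<Rightarrow> 'd \<Rightarrow> real" where
  "coord w (Centre j) l = 4 * real j"
| "coord w (Half j i t) l = 4 * real j + (if l = i then of_int t / 2 else 0)"
| "coord w (Outer j i) l = 4 * real j + (if l = i then 11 / 10 * of_int (w (j, i)) else 0)"
| "coord w (Counter j i) l = 4 * real j - (if l = i then of_int (w (j, i)) else 0)"

definition point :: "(nat \<times> 'd \<Rightarrow> int) \<Rightarrow> 'd slot \<Rightarrow> real ^ 'd" where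
  "point w s = (\<chi> l. coord w s l)"

definition near :: "(nat \<times> 'd \<Rightarrow> int) \<Rightarrow> 'd slot \<Rightarrow> 'd slot \<Rightarrow> bool" where
  "near w s s' \<longleftrightarrow> (\<forall>l. \<bar>coord w s l - coord w s' l\<bar> \<le> 1)"

lemma infnorm_point: "infnorm (point w s - point w s') \<le> 1 \<longleftrightarrow> near w s s'"
  by (simp add: infnorm_le_iff near_def point_def)

definition early :: "'d list \<Rightarrow> nat \<Rightarrow> 'd slot list" where
  "early ds j = Centre j # concat (map (\<lambda>i. [Half j i 1, Half j i (-1)]) ds)"

definition late :: "'d list \<Rightarrow> nat \<Rightarrow> 'd slot list" where
  "late ds j = concat (map (\<lambda>i. [Outer j i, Counter j i]) ds)"

definition slots :: "'d list \<Rightarrow> nat \<Rightarrow> 'd slot list" where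
  "slots ds k = concat (map (\<lambda>j. early ds j @ late ds j) [0..<k])"

lemma slots_Suc: "slots ds (Suc k) = slots ds k @ early ds k @ late ds k"
  by (simp add: slots_def)

lemma set_early: "set (early ds j) = {Centre j} \<union> {Half j i t | i t. i \<in> set ds \<and> t \<in> {1, -1}}"
  by (auto simp: early_def)

lemma set_late: "set (late ds j) = {Outer j i | i. i \<in> set ds} \<union> {Counter j i | i. i \<in> set ds}"
  by (auto simp: late_def)

lemma set_slots: "set (slots ds k) = (\<Union>j<k. set (early ds j) \<union> set (late ds j))"
  by (auto simp: slots_def)

lemma block_slots: "s \<in> set (slots ds k) \<Longrightarrow> block s < k"
  by (auto simp: set_slots set_early set_late)

lemma length_slots: "length (slots ds k) = k * (1 + 4 * length ds)"
proof (induction k)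
  case (Suc k)
  have "length (early ds k) = 1 + 2 * length ds" "length (late ds k) = 2 * length ds"
    by (induction ds) (auto simp: early_def late_def)
  then show ?case using Suc by (simp add: slots_Suc algebra_simps)
qed (simp add: slots_def)

lemma distinct_slots:
  assumes "distinct ds"
  shows "distinct (slots ds k)"
proof (induction k)
  case (Suc k)
  have "distinct (early ds k)" "distinct (late ds k)"
    using assms by (induction ds) (auto simp: early_def late_def)
  moreover have "set (slots ds k) \<inter> set (early ds k @ late ds k) = {}"
    using block_slots[of _ ds k] by (fastforce simp: set_early set_late)
  moreover have "set (early ds k) \<inter> set (late ds k) = {}"
    by (auto simp: set_early set_late)
  ultimately show ?case using Suc by (simp add: slots_Suc)
qed (simp add: slots_def)

lemma slots_split:
  assumes "j < k"
  shows "\<exists>R. slots ds k = slots ds j @ early ds j @ R"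
proof -
  have "[0..<k] = [0..<j] @ j # [Suc j..<k]"
    using assms by (metis less_imp_add_positive less_or_eq_imp_le upt_add_eq_append upt_conv_Cons zero_le)
  then show ?thesis by (simp add: slots_def)
qed

section \<open>Optimal clusterings of the gadgets\<close>

text \<open>The intended optimal clustering. Each cluster is named after one of its own slots,
  chosen so that these representatives are pairwise more than 1 apart.\<close>

fun owner :: "(nat \<times> 'd \<Rightarrow> int) \<Rightarrow> 'd slot \<Rightarrow> 'd slot" where
  "owner w (Centre j) = Centre j"
| "owner w (Half j i t) = (if w (j, i) = t then Outer j i else Centre j)"
| "owner w (Outer j i) = (if w (j, i) = 0 then Centre j else Outer j i)"
| "owner w (Counter j i) = Centre j"

locale gadgets =
  fixes ds :: "'d::finite list" and w :: "nat \<times> 'd \<Rightarrow> int" and k :: nat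
  assumes dist: "distinct ds" and univ: "set ds = UNIV"
    and signs: "\<And>j i. j < k \<Longrightarrow> w (j, i) \<in> {-1, 0, 1}"
begin

abbreviation "S \<equiv> set (slots ds k)"

definition anchors :: "'d slot set" where
  "anchors = owner w ` S"

lemma slots_iff [simp]:
  "Centre j \<in> S \<longleftrightarrow> j < k" "Half j i t \<in> S \<longleftrightarrow> j < k \<and> t \<in> {1, -1}"
  "Outer j i \<in> S \<longleftrightarrow> j < k" "Counter j i \<in> S \<longleftrightarrow> j < k"
  by (auto simp: set_slots set_early set_late univ)

lemma anchors_iff [simp]:
  "Centre j \<in> anchors \<longleftrightarrow> j < k" "Outer j i \<in> anchors \<longleftrightarrow> j < k \<and> w (j, i) \<noteq> 0"
  "Half j i t \<notin> anchors" "Counter j i \<notin> anchors"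
proof -
  have own: "owner w s \<in> {Centre (block s)} \<union> {Outer (block s) i | i. w (block s, i) \<noteq> 0}"
    if "s \<in> S" for s
    by (cases s) (use that in auto)
  show "Half j i t \<notin> anchors" "Counter j i \<notin> anchors"
    using own by (fastforce simp: anchors_def)+
  show "Centre j \<in> anchors \<longleftrightarrow> j < k"
  proof
    assume "j < k"
    then show "Centre j \<in> anchors"
      unfolding anchors_def by (intro image_eqI[where x = "Centre j"]) auto
  qed (use own block_slots in \<open>fastforce simp: anchors_def\<close>)
  show "Outer j i \<in> anchors \<longleftrightarrow> j < k \<and> w (j, i) \<noteq> 0"
  proof
    assume "j < k \<and> w (j, i) \<noteq> 0"
    then show "Outer j i \<in> anchors"
      unfolding anchors_def by (intro image_eqI[where x = "Outer j i"]) auto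
  qed (use own block_slots in \<open>fastforce simp: anchors_def\<close>)
qed

lemma anchors_subset: "anchors \<subseteq> S"
proof
  fix a assume "a \<in> anchors"
  then show "a \<in> S" by (cases a) auto
qed

lemma coord_bound:
  assumes "s \<in> S"
  shows "\<bar>coord w s l - 4 * real (block s)\<bar> \<le> 11 / 10"
  by (cases s) (use assms signs[of "block s" l] in \<open>auto split: if_splits\<close>)

text \<open>Centres of different gadgets differ by at least 4 on every axis, whereas near points
  allow a gap of at most 1 + 2 * 11/10 < 4.\<close>

lemma near_block:
  assumes "s \<in> S" "s' \<in> S" "near w s s'"
  shows "block s = block s'"
proof -
  fix l :: 'd
  have "\<bar>coord w s l - coord w s' l\<bar> \<le> 1"
    using assms(3) by (simp add: near_def)
  then have "\<bar>4 * real (block s) - 4 * real (block s')\<bar> < 4"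
    using coord_bound[OF assms(1), of l] coord_bound[OF assms(2), of l] by linarith
  then show ?thesis by linarith
qed

text \<open>On axis \<open>i\<close> the anchor is displaced from the centre by 11/10 > 1, and
  \<open>s\<close> not at all.\<close>

lemma far_Outer:
  assumes "Outer j i \<in> anchors" "coord w s i = 4 * real j"
  shows "\<not> near w s (Outer j i)" "\<not> near w (Outer j i) s"
  using assms signs[of j i] unfolding near_def by (auto intro!: exI[of _ i])

lemma near_anchors:
  assumes "a \<in> anchors" "b \<in> anchors" "near w a b"
  shows "a = b"
proof (rule ccontr)
  assume "a \<noteq> b"
  have "block a = block b"
    using near_block assms anchors_subset by blast
  show False
  proof (cases a)
    case (Outer j i)
    have "coord w b i = 4 * real j"
      by (cases b) (use \<open>block a = block b\<close> \<open>a \<noteq> b\<close> assms(2) Outer in auto)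
    then show False using far_Outer(2)[of j i b] assms(1,3) Outer by simp
  next
    case (Centre j)
    then obtain i where "b = Outer j i"
      using \<open>block a = block b\<close> \<open>a \<noteq> b\<close> assms(2) by (cases b) auto
    then show False using far_Outer(1)[of j i a] assms(2,3) Centre by simp
  qed (use assms(1) in auto)
qed

text \<open>Outer anchors on other axes are excluded by \<open>far_Outer\<close>. On axis
  \<open>i\<close> the sign could only be \<open>- t\<close>, giving distance 1/2 + 11/10.\<close>

lemma near_Half:
  assumes "j < k" "t \<in> {1, -1}" "w (j, i) \<noteq> t" "a \<in> anchors" "near w (Half j i t) a"
  shows "a = Centre j"
proof -
  have bl: "block a = j"
    using near_block[of "Half j i t" a] assms anchors_subset by auto
  show ?thesis
  proof (cases a)
    case (Outer j' i')
    then have [simp]: "j' = j" using bl by simp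
    have "i' = i"
    proof (rule ccontr)
      assume "i' \<noteq> i"
      then show False using far_Outer(1)[of j i' "Half j i t"] assms Outer by auto
    qed
    then have "\<bar>of_int t / 2 - 11 / 10 * real_of_int (w (j, i))\<bar> \<le> 1"
      using assms(5) Outer by (auto simp: near_def dest: spec[of _ i])
    then show ?thesis
      using assms signs[of j i] Outer \<open>i' = i\<close> by auto
  qed (use bl assms in auto)
qed

text \<open>The counter point lies opposite to the outer point of its axis, at distance 1 + 11/10,
  so only the centre can be its anchor.\<close>

lemma near_Counter:
  assumes "j < k" "w (j, i) \<noteq> 0" "a \<in> anchors" "near w (Counter j i) a"
  shows "a = Centre j"
proof -
  have bl: "block a = j"
    using near_block[of "Counter j i" a] assms anchors_subset by auto
  show ?thesis
  proof (cases a)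
    case (Outer j' i')
    then have [simp]: "j' = j" using bl by simp
    have "i' = i"
    proof (rule ccontr)
      assume "i' \<noteq> i"
      then show False using far_Outer(1)[of j i' "Counter j i"] assms Outer by auto
    qed
    then have "\<bar>of_int (w (j, i)) + 11 / 10 * real_of_int (w (j, i))\<bar> \<le> 1"
      using assms(4) Outer by (auto simp: near_def dest: spec[of _ i])
    then show ?thesis
      using assms signs[of j i] by auto
  qed (use bl assms in auto)
qed

lemma near_same_owner:
  assumes "s \<in> S" "s' \<in> S" "owner w s = owner w s'"
  shows "near w s s'"
proof -
  \<comment> \<open>On axis \<open>l\<close> the cluster of the centre fills at most a unit
    interval: from the centre to the counter point if the sign is nonzero, between the two half
    points if it is 0. Its midpoint is shifted by minus half the sign.\<close>
  have half: "\<bar>coord w s l - 4 * real j + of_int (w (j, l)) / 2\<bar> \<le> 1 / 2"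
    if "s \<in> S" "owner w s = Centre j" for s j l
    by (cases s) (use that signs[of j l] in \<open>auto split: if_splits\<close>)
  \<comment> \<open>This cluster holds the outer point and the half point of the same sign, at
    offsets 11/10 and 1/2: midpoint 4/5, radius 3/10.\<close>
  have outer: "\<bar>coord w s l - 4 * real j - (if l = i then 4 / 5 * of_int (w (j, i)) else 0)\<bar> \<le> 3 / 10"
    if "s \<in> S" "owner w s = Outer j i" for s j i l
    by (cases s) (use that signs[of j i] in \<open>auto split: if_splits\<close>)
  show ?thesis
  proof (cases "owner w s")
    case (Centre j)
    show ?thesis
      unfolding near_def
    proof
      fix l
      show "\<bar>coord w s l - coord w s' l\<bar> \<le> 1"
        using half[OF assms(1) Centre, of l] half[OF assms(2) assms(3)[symmetric, unfolded Centre], of l]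
        by linarith
    qed
  next
    case (Outer j i)
    show ?thesis
      unfolding near_def
    proof
      fix l
      show "\<bar>coord w s l - coord w s' l\<bar> \<le> 1"
        using outer[OF assms(1) Outer, of l] outer[OF assms(2) assms(3)[symmetric, unfolded Outer], of l]
        by linarith
    qed
  next
    case (Half j i t)
    then show ?thesis by (cases s) (auto split: if_splits)
  next
    case (Counter j i)
    then show ?thesis by (cases s) (auto split: if_splits)
  qed
qed

lemma inj_on_anchors:
  assumes "unit_clustering (map (point w) (slots ds k)) (map f (slots ds k))"
  shows "inj_on f anchors"
proof (rule inj_onI)
  fix a b assume ab: "a \<in> anchors" "b \<in> anchors" "f a = f b"
  then have "near w a b"
    using assms anchors_subset unfolding unit_clustering_map_iff[OF distinct_slots[OF dist]]
    by (auto simp: infnorm_point)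
  then show "a = b" using near_anchors ab by blast
qed

text \<open>Labelling by \<open>owner\<close>, with slots encoded as naturals by \<open>e\<close>,
  attains the bound; no fewer labels suffice because no two anchors can share one.\<close>

lemma opt_cost_gadgets: "opt_cost (map (point w) (slots ds k)) = card anchors"
  unfolding opt_cost_def
proof (rule Least_equality)
  obtain e :: "'d slot \<Rightarrow> nat" where e: "inj_on e S"
    using finite_imp_inj_to_nat_seg[of S] by auto
  have "inj_on e anchors" using e anchors_subset inj_on_subset by blast
  then have c: "cost (map (e \<circ> owner w) (slots ds k)) = card anchors"
    unfolding cost_def by (simp add: image_comp[symmetric] anchors_def card_image del: o_apply)
  have "unit_clustering (map (point w) (slots ds k)) (map (e \<circ> owner w) (slots ds k))"
    unfolding unit_clustering_map_iff[OF distinct_slots[OF dist]] infnorm_point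
    using near_same_owner \<open>inj_on e anchors\<close> by (auto simp: anchors_def inj_on_def)
  with c show "\<exists>cs. unit_clustering (map (point w) (slots ds k)) cs \<and> cost cs = card anchors"
    by blast
next
  fix m assume "\<exists>cs. unit_clustering (map (point w) (slots ds k)) cs \<and> cost cs = m"
  then obtain cs where cs: "unit_clustering (map (point w) (slots ds k)) cs" "cost cs = m"
    by blast
  then obtain f where f: "cs = map f (slots ds k)"
    using map_label_obtain[OF distinct_slots[OF dist, of k], of cs]
    by (auto simp: unit_clustering_def)
  have "card anchors = card (f ` anchors)"
    using inj_on_anchors cs(1) f by (simp add: card_image)
  also have "\<dots> \<le> card (f ` S)"
    using anchors_subset by (intro card_mono) auto
  finally show "card anchors \<le> m" using cs(2) f by (simp add: cost_def)
qed

text \<open>In an optimal solution every cluster contains an anchor.\<close>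

lemma optimal_reveals_sign:
  assumes opt: "optimal_clustering (map (point w) (slots ds k)) (map f (slots ds k))"
    and j: "j < k" and t: "t \<in> {1, -1}"
  shows "w (j, i) = t \<longleftrightarrow> f (Half j i t) \<noteq> f (Centre j)"
proof -
  have uc: "unit_clustering (map (point w) (slots ds k)) (map f (slots ds k))"
    and c: "card (f ` S) = card anchors"
    using opt by (auto simp: optimal_clustering_def opt_cost_gadgets cost_def)
  have near: "near w s s'" if "s \<in> S" "s' \<in> S" "f s = f s'" for s s'
    using uc that unfolding unit_clustering_map_iff[OF distinct_slots[OF dist]]
    by (auto simp: infnorm_point)
  \<comment> \<open>The anchors have pairwise different labels, and optimality permits no more
    labels than anchors.\<close>
  have "f ` anchors = f ` S"
    using c inj_on_anchors[OF uc] anchors_subset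
    by (intro card_subset_eq) (auto simp: card_image)
  then have anchor: "\<exists>a\<in>anchors. f s = f a \<and> near w s a" if "s \<in> S" for s
  proof -
    from that \<open>f ` anchors = f ` S\<close> obtain a where "a \<in> anchors" "f s = f a"
      by (metis imageE imageI)
    then show ?thesis using near[OF that] anchors_subset by blast
  qed
  show ?thesis
  proof
    assume eq: "w (j, i) = t"
    \<comment> \<open>The counter point is forced into the cluster of the centre. It is 3/2 away
      from the half point of sign \<open>t\<close>, which is thereby expelled.\<close>
    then have "f (Counter j i) = f (Centre j)"
      using anchor[of "Counter j i"] near_Counter[of j i] j t by auto
    moreover have "\<not> near w (Half j i t) (Counter j i)"
      using eq t by (auto simp: near_def intro!: exI[of _ i])
    ultimately show "f (Half j i t) \<noteq> f (Centre j)"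
      using near[of "Half j i t" "Counter j i"] j t by auto
  next
    assume "f (Half j i t) \<noteq> f (Centre j)"
    then show "w (j, i) = t"
      using anchor[of "Half j i t"] near_Half[of j t i] j t by auto
  qed
qed

end

section \<open>Counting advice strings\<close>

text \<open>Centres and half points ignore the word, so up to the early part of gadget
  \<open>j\<close> the input shows only the signs of earlier gadgets.\<close>

lemma early_points_cong:
  assumes "\<And>j' i. j' < j \<Longrightarrow> w (j', i) = w' (j', i)"
  shows "map (point w) (slots ds j @ early ds j) = map (point w') (slots ds j @ early ds j)"
proof -
  have "point w s = point w' s" if "s \<in> set (slots ds j @ early ds j)" for s
  proof -
    have "coord w s l = coord w' s l" for l
      by (cases s) (use that assms in \<open>auto simp: set_slots set_early set_late\<close>)
    then show ?thesis by (simp add: point_def)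
  qed
  then show ?thesis by simp
qed

text \<open>Only inputs of the single length used by the adversary must be served, so the bound also
  covers algorithms that are optimal on long sequences only.\<close>

lemma advice_lower_bound:
  fixes A :: "'d::finite online_algorithm" and tape_for :: "'d oracle_fun"
  assumes serves: "\<And>\<sigma>. length \<sigma> = k * (1 + 4 * CARD('d)) \<Longrightarrow>
    \<exists>cs b. run A (tape_for \<sigma>) \<sigma> cs b \<and> optimal_clustering \<sigma> cs"
  shows "\<exists>\<sigma> cs b. length \<sigma> = k * (1 + 4 * CARD('d)) \<and> run A (tape_for \<sigma>) \<sigma> cs b \<and>
    real b \<ge> real (k * CARD('d)) * log 2 3"
proof -
  obtain ds :: "'d list" where ds: "set ds = UNIV" "distinct ds"
    using finite_distinct_list[of UNIV] finite_class.finite_UNIV by blast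
  then have card_ds: "length ds = CARD('d)" by (metis distinct_card)
  \<comment> \<open>Extensionality fixes the words outside the \<open>k\<close> gadgets, so that
    they can be counted and differ only in signs that matter.\<close>
  define W where "W = ({..<k} \<times> (UNIV :: 'd set)) \<rightarrow>\<^sub>E {-1, 0, 1::int}"
  define req where "req w = map (point w) (slots ds k)" for w :: "nat \<times> 'd \<Rightarrow> int"
  have len: "length (req w) = k * (1 + 4 * CARD('d))" for w
    by (simp add: req_def length_slots card_ds)
  have W: "finite W" "card W = 3 ^ (k * CARD('d))"
    by (auto simp: W_def card_funcsetE card_cartesian_product numeral_3_eq_3 intro!: finite_PiE)
  then have "W \<noteq> {}" by auto
  obtain cs b where cs: "\<And>w. run A (tape_for (req w)) (req w) (cs w) (b w)"
      "\<And>w. optimal_clustering (req w) (cs w)"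
    using serves[OF len] by metis
  have gad: "gadgets ds w k" if "w \<in> W" for w
    using that ds by unfold_locales (auto simp: W_def PiE_iff)
  \<comment> \<open>All tapes are cut at one common length, the largest number of bits read.
    Injectivity into strings of length \<open>B\<close> then replaces the count of a prefix-free
    code.\<close>
  define B where "B = Max (b ` W)"
  have B: "b w \<le> B" if "w \<in> W" for w
    using that W(1) by (simp add: B_def)
  have "inj_on (\<lambda>w. tape_prefix (tape_for (req w)) B) W"
  proof (rule inj_onI, rule ccontr)
    fix w w' assume ww: "w \<in> W" "w' \<in> W" "w \<noteq> w'"
      and same: "tape_prefix (tape_for (req w)) B = tape_prefix (tape_for (req w')) B"
    have "\<exists>j. j < k \<and> (\<exists>i. w (j, i) \<noteq> w' (j, i))"
    proof (rule ccontr)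
      assume "\<not> ?thesis"
      then have "w x = w' x" if "x \<in> {..<k} \<times> UNIV" for x using that by auto
      then show False using PiE_ext ww unfolding W_def by blast
    qed
    \<comment> \<open>The first gadget on which the words differ: both inputs agree up to and
      including its early part.\<close>
    then obtain j where j: "j < k" "\<exists>i. w (j, i) \<noteq> w' (j, i)"
        "\<And>j'. j' < j \<Longrightarrow> \<not> (j' < k \<and> (\<exists>i. w (j', i) \<noteq> w' (j', i)))"
      using exists_least_iff[of "\<lambda>j. j < k \<and> (\<exists>i. w (j, i) \<noteq> w' (j, i))"] by blast
    define E where "E = slots ds j @ early ds j"
    define P where "P = map (point w) E"
    obtain R where R: "slots ds k = E @ R"
      using slots_split[OF j(1)] by (auto simp: E_def)
    have P': "P = map (point w') E"
      unfolding P_def E_def using j by (intro early_points_cong) auto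
    have lcs: "length (cs v) = length (slots ds k)" for v
      using cs(2)[of v] by (simp add: optimal_clustering_def unit_clustering_def req_def)
    obtain f f' where f: "cs w = map f (slots ds k)" "cs w' = map f' (slots ds k)"
      using map_label_obtain[OF distinct_slots[OF ds(2)] lcs] by meson
    obtain c where c: "c \<le> b w" "run A (tape_for (req w)) P (map f E) c"
      using run_append[OF cs(1)[of w], of P "map (point w) R"]
      by (auto simp: f R req_def P_def)
    obtain c' where c': "run A (tape_for (req w')) P (map f' E) c'"
      using run_append[OF cs(1)[of w'], of P "map (point w') R"]
      by (auto simp: f R req_def P')
    \<comment> \<open>The run for \<open>w\<close> on \<open>P\<close> reads at most
      \<open>B\<close> bits, so it is also a run on the other tape; uniqueness makes the early
      labels coincide.\<close>
    have "run A (tape_for (req w')) P (map f E) c"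
      using run_tape_cong[OF c(2) same] c(1) B[OF ww(1)] by simp
    then have "map f E = map f' E" using run_unique c' by blast
    then have ff: "f s = f' s" if "s \<in> set (early ds j)" for s
      using that by (simp add: E_def)
    have iff: "w (j, i) = t \<longleftrightarrow> w' (j, i) = t" if "t \<in> {1, -1}" for i t
      using gadgets.optimal_reveals_sign[OF gad[OF ww(1)] _ j(1) that, of f i]
        gadgets.optimal_reveals_sign[OF gad[OF ww(2)] _ j(1) that, of f' i]
        cs(2)[of w] cs(2)[of w'] ff[of "Half j i t"] ff[of "Centre j"] that
      by (auto simp: f req_def set_early ds)
    \<comment> \<open>The tests for 1 and -1 determine a sign; it is 0 when both fail.\<close>
    have "w (j, i) = w' (j, i)" for i
      using iff[of 1 i] iff[of "-1" i] gadgets.signs[OF gad[OF ww(1)] j(1), of i]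
        gadgets.signs[OF gad[OF ww(2)] j(1), of i] by auto
    then show False using j(2) by blast
  qed
  then have "card W = card ((\<lambda>w. tape_prefix (tape_for (req w)) B) ` W)"
    by (simp add: card_image)
  also have "\<dots> \<le> card {xs :: bool list. set xs \<subseteq> UNIV \<and> length xs = B}"
    by (intro card_mono finite_lists_length_eq) (auto simp: tape_prefix_def)
  also have "\<dots> = 2 ^ B" by (subst card_lists_length_eq) auto
  finally have "(3::real) ^ (k * CARD('d)) \<le> 2 ^ B"
    unfolding W(2) by (metis of_nat_le_iff of_nat_numeral of_nat_power)
  then have "log 2 ((3::real) ^ (k * CARD('d))) \<le> log 2 (2 ^ B)"
    by (subst log_le_cancel_iff) auto
  then have "real (k * CARD('d)) * log 2 3 \<le> real B"
    by (simp add: log_nat_power)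
  \<comment> \<open>The maximum is attained, so a single input requires \<open>B\<close>
    bits.\<close>
  moreover have "B \<in> b ` W"
    unfolding B_def using W(1) \<open>W \<noteq> {}\<close> by (intro Max_in) auto
  ultimately show ?thesis using cs(1) len by blast
qed

theorem theorem1:
  shows "\<not> (\<exists>(A :: 'd::finite online_algorithm) (tape_for :: 'd oracle_fun) (n :: nat).
            \<forall>\<sigma>. length \<sigma> \<ge> n \<longrightarrow>
              (\<exists>cs b. run A (tape_for \<sigma>) \<sigma> cs b \<and> optimal_clustering \<sigma> cs \<and>
                 real b < real CARD('d) * log 2 3 / (1 + 4 * real CARD('d)) * real (length \<sigma>)))
       \<and> (\<forall>(A :: 'd online_algorithm) (tape_for :: 'd oracle_fun).
            (\<forall>\<sigma>. \<exists>cs b. run A (tape_for \<sigma>) \<sigma> cs b \<and> optimal_clustering \<sigma> cs) \<longrightarrow>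
            (\<forall>N. \<exists>n \<ge> N. \<exists>\<sigma> cs b. length \<sigma> = n \<and> run A (tape_for \<sigma>) \<sigma> cs b \<and>
                 real b \<ge> real CARD('d) * log 2 3 / (1 + 4 * real CARD('d)) * real n))"
proof -
  have rate: "real CARD('d) * log 2 3 / (1 + 4 * real CARD('d)) * real (k * (1 + 4 * CARD('d)))
      = real (k * CARD('d)) * log 2 3" for k
  proof -
    define y where "y = 1 + 4 * real CARD('d)"
    have "y \<noteq> 0" unfolding y_def by linarith
    moreover have "real (k * (1 + 4 * CARD('d))) = real k * y" by (simp add: y_def distrib_left)
    ultimately show ?thesis unfolding y_def[symmetric] by simp
  qed
  have ge: "k \<le> k * (1 + 4 * CARD('d))" for k by simp
  show ?thesis
  proof (intro conjI notI allI impI)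
    assume "\<exists>(A :: 'd online_algorithm) (tape_for :: 'd oracle_fun) (n :: nat).
      \<forall>\<sigma>. length \<sigma> \<ge> n \<longrightarrow> (\<exists>cs b. run A (tape_for \<sigma>) \<sigma> cs b \<and> optimal_clustering \<sigma> cs \<and>
        real b < real CARD('d) * log 2 3 / (1 + 4 * real CARD('d)) * real (length \<sigma>))"
    then obtain A :: "'d online_algorithm" and tape_for :: "'d oracle_fun" and n where
      *: "\<And>\<sigma>. length \<sigma> \<ge> n \<Longrightarrow> \<exists>cs b. run A (tape_for \<sigma>) \<sigma> cs b \<and> optimal_clustering \<sigma> cs \<and>
        real b < real CARD('d) * log 2 3 / (1 + 4 * real CARD('d)) * real (length \<sigma>)"
      by blast
    \<comment> \<open>The threshold \<open>n\<close> also serves as the number of gadgets, which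
      makes the input long enough.\<close>
    have "\<exists>cs b. run A (tape_for \<sigma>) \<sigma> cs b \<and> optimal_clustering \<sigma> cs"
      if "length \<sigma> = n * (1 + 4 * CARD('d))" for \<sigma>
      using *[of \<sigma>] ge[of n] unfolding that by blast
    then obtain \<sigma> cs b where \<sigma>: "length \<sigma> = n * (1 + 4 * CARD('d))" "run A (tape_for \<sigma>) \<sigma> cs b"
        "real b \<ge> real (n * CARD('d)) * log 2 3"
      using advice_lower_bound[of n A tape_for] by blast
    obtain cs' b' where "run A (tape_for \<sigma>) \<sigma> cs' b'" "real b' < real (n * CARD('d)) * log 2 3"
      using *[of \<sigma>] ge[of n] unfolding \<sigma>(1) rate by blast
    then show False using run_unique[OF \<sigma>(2)] \<sigma>(3) by fastforce
  next
    fix A :: "'d online_algorithm" and tape_for :: "'d oracle_fun" and N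
    assume "\<forall>\<sigma>. \<exists>cs b. run A (tape_for \<sigma>) \<sigma> cs b \<and> optimal_clustering \<sigma> cs"
    then have "\<exists>\<sigma> cs b. length \<sigma> = N * (1 + 4 * CARD('d)) \<and> run A (tape_for \<sigma>) \<sigma> cs b \<and>
        real b \<ge> real (N * CARD('d)) * log 2 3"
      by (intro advice_lower_bound) auto
    then show "\<exists>n \<ge> N. \<exists>\<sigma> cs b. length \<sigma> = n \<and> run A (tape_for \<sigma>) \<sigma> cs b \<and>
        real b \<ge> real CARD('d) * log 2 3 / (1 + 4 * real CARD('d)) * real n"
      unfolding rate[of N, symmetric] using ge[of N] by blast
  qed
qed

end
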